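(* Let $$G=\mathbb{Z}_3\times D_6=\langle X,Y,Z \mid X^3=Y^3=Z^2=1,\ XZ=ZX^{-1},\ YX=XY,\ YZ=ZY\rangle$$ (of order 18, SmallGroup(18,3) in GAP's library), and let $\mathcal{S}(G)\subseteq\mathbb{Z}$ be the set of integer group determinants for $G$. Then: (i) the elements of $\mathcal{S}(G)$ coprime to $6$ are exactly the integers $m$ with $m\equiv \pm 1 \pmod{18}$; (ii) the elements of $\mathcal{S}(G)$ divisible by $6$ are exactly the integers $2^2\cdot 3^6 m$ with $m\in\mathbb{Z}$; (iii) the elements of $\mathcal{S}(G)$ divisible by $2$ but not by $3$ are exactly the integers $2^2(9m+2)$ and $2^2(9m-2)$ with $m\in\mathbb{Z}$; (iv) the elements of $\mathcal{S}(G)$ divisible by $3$ but not by $2$ are exactly the integers $3^6(2m+1)$ with $m\in\mathbb{Z}$.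
   Context: For a finite group $G$ and an element $\sum_{g\in G}a_g g$ of the integral group ring $\mathbb{Z}[G]$, the integer group determinant is $$\mathcal{D}_G\Big(\sum_{g\in G}a_g g\Big):=\det\big(a_{gh^{-1}}\big)_{g,h\in G},$$ the determinant of the $|G|\times|G|$ matrix whose rows are indexed by $g\in G$ and columns by $h\in G$ (in the same order). The set of integer group determinants for $G$ is $\mathcal{S}(G):=\{\mathcal{D}_G(F) : F\in\mathbb{Z}[G]\}$. $\mathbb{Z}_n$ and $D_n$ denote the cyclic and dihedral groups of order $n$; in particular $D_6$ is the dihedral group with 6 elements. *)

theory Defs
  imports "HOL-Algebra.Algebra" "HOL-Number_Theory.Cong" "Jordan_Normal_Form.Determinant"
begin

text \<open>
  An element \<open>\<Sum>g. a g \<cdot> g\<close> of the integral group ring of a finite group \<open>G\<close> is represented by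
  its coefficient function \<open>a\<close>; only the values of \<open>a\<close> on \<open>carrier G\<close> matter.

  The matrices of \<open>Jordan_Normal_Form\<close> are indexed by natural numbers, so the group elements are
  listed in some order, the same for rows and columns. The choice of the order is
  irrelevant, see \<open>group_det_eq\<close> below.
\<close>

definition group_enum :: "('a, 'b) monoid_scheme \<Rightarrow> nat \<Rightarrow> 'a" where
  "group_enum G = (SOME e. bij_betw e {0..<card (carrier G)} (carrier G))"

definition group_det :: "('a, 'b) monoid_scheme \<Rightarrow> ('a \<Rightarrow> int) \<Rightarrow> int" where
  "group_det G a =
     (let n = card (carrier G); e = group_enum G
      in det (mat n n (\<lambda>(i, j). a (e i \<otimes>\<^bsub>G\<^esub> inv\<^bsub>G\<^esub> (e j)))))"

definition integer_group_dets :: "('a, 'b) monoid_scheme \<Rightarrow> int set" where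
  "integer_group_dets G = {group_det G a | a. True}"

text \<open>
  The dihedral group of order \<open>n\<close>, for even \<open>n\<close>: the pair \<open>(i, s)\<close> stands for \<open>X\<^sup>i Z\<^sup>s\<close>, where
  \<open>X\<close> is the rotation of order \<open>n / 2\<close> and \<open>Z\<close> a reflection, so \<open>Z X = X\<^sup>-\<^sup>1 Z\<close>.
\<close>

definition dihedral_group :: "nat \<Rightarrow> (int \<times> bool) monoid" where
  "dihedral_group n =
     \<lparr>carrier = {0..<int (n div 2)} \<times> UNIV,
      monoid.mult = (\<lambda>(i, s) (j, t). ((if s then i - j else i + j) mod int (n div 2), s \<noteq> t)),
      one = (0, False)\<rparr>"

definition Z3_times_D6 :: "(int \<times> int \<times> bool) monoid" where
  "Z3_times_D6 = integer_mod_group 3 \<times>\<times> dihedral_group 6"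

lemma group_enum_bij:
  assumes "finite (carrier G)"
  shows "bij_betw (group_enum G) {0..<card (carrier G)} (carrier G)"
  unfolding group_enum_def
  using ex_bij_betw_nat_finite [OF assms] by (rule someI_ex)

theorem group_det_eq:
  assumes fin: "finite (carrier G)"
    and n: "n = card (carrier G)"
    and e: "bij_betw e {0..<n} (carrier G)"
  shows "group_det G a = det (mat n n (\<lambda>(i, j). a (e i \<otimes>\<^bsub>G\<^esub> inv\<^bsub>G\<^esub> (e j))))"
proof -
  let ?e = "group_enum G"
  define f where "f = (\<lambda>x y. a (x \<otimes>\<^bsub>G\<^esub> inv\<^bsub>G\<^esub> y))"
  define A where "A = mat n n (\<lambda>(i, j). f (?e i) (?e j))"
  define p where "p i = (if i \<in> {0..<n} then inv_into {0..<n} ?e (e i) else i)" for i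
  have b: "bij_betw ?e {0..<n} (carrier G)"
    using group_enum_bij [OF fin] n by simp
  have "bij_betw (inv_into {0..<n} ?e \<circ> e) {0..<n} {0..<n}"
    using bij_betw_trans [OF e bij_betw_inv_into [OF b]] .
  then have "bij_betw p {0..<n} {0..<n}"
    by (subst bij_betw_cong [where g = "inv_into {0..<n} ?e \<circ> e"]) (auto simp: p_def)
  then have p: "p permutes {0..<n}"
    by (rule bij_imp_permutes) (auto simp: p_def)
  have ep: "?e (p i) = e i" if "i < n" for i
    using that b e by (auto simp: p_def bij_betw_def intro!: f_inv_into_f)
  have pl: "p i < n" if "i < n" for i
    using permutes_in_image [OF p, of i] that by simp
  have A: "A \<in> carrier_mat n n" by (simp add: A_def)
  define B where "B = mat n n (\<lambda>(i, j). A $$ (p i, j))"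
  have B: "B \<in> carrier_mat n n" by (simp add: B_def)
  have C: "mat n n (\<lambda>(i, j). transpose_mat B $$ (p i, j)) =
      transpose_mat (mat n n (\<lambda>(i, j). f (e i) (e j)))"
    by (rule eq_matI) (auto simp: A_def B_def ep pl)
  have "det (mat n n (\<lambda>(i, j). f (e i) (e j))) =
      det (transpose_mat (mat n n (\<lambda>(i, j). f (e i) (e j))))"
    by (subst det_transpose) auto
  also have "\<dots> = signof p * det (transpose_mat B)"
    unfolding C [symmetric] by (rule det_permute_rows) (use B p in auto)
  also have "det (transpose_mat B) = det B"
    using B by (rule det_transpose)
  also have "det B = signof p * det A"
    unfolding B_def by (rule det_permute_rows [OF A p])
  also have "signof p * (signof p * det A) = det A"
    by (simp add: sign_def)
  finally show ?thesis
    by (simp add: group_det_def Let_def A_def f_def n)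
qed

lemma group_dihedral_group:
  assumes "n \<ge> 2"
  shows "group (dihedral_group n)"
proof -
  define k where "k = int (n div 2)"
  have k: "k > 0" using assms by (simp add: k_def div_greater_zero_iff)
  have D: "dihedral_group n = \<lparr>carrier = {0..<k} \<times> UNIV,
      monoid.mult = (\<lambda>(i, s) (j, t). ((if s then i - j else i + j) mod k, s \<noteq> t)),
      one = (0, False)\<rparr>"
    by (simp add: dihedral_group_def k_def)
  have inv: "\<exists>y\<in>carrier (dihedral_group n).
      y \<otimes>\<^bsub>dihedral_group n\<^esub> x = \<one>\<^bsub>dihedral_group n\<^esub>"
    if "x \<in> carrier (dihedral_group n)" for x
  proof (cases x)
    case (Pair i s)
    show ?thesis
      by (rule bexI [where x = "(if s then i else (- i) mod k, s)"])
        (use that k in \<open>auto simp: D Pair mod_simps\<close>)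
  qed
  show ?thesis
    by (rule groupI)
      (use k inv in \<open>auto simp: D mod_simps algebra_simps\<close>)
qed

lemma group_Z3_times_D6: "group Z3_times_D6"
  unfolding Z3_times_D6_def by (intro DirProd_group group_dihedral_group) auto

lemma carrier_Z3_times_D6: "carrier Z3_times_D6 = {0, 1, 2} \<times> {0, 1, 2} \<times> UNIV"
  by (auto simp: Z3_times_D6_def dihedral_group_def carrier_integer_mod_group)

lemma mult_Z3_times_D6:
  "(i, j, s) \<otimes>\<^bsub>Z3_times_D6\<^esub> (i', j', s') =
    ((i + i') mod 3, (if s then j - j' else j + j') mod 3, s \<noteq> s')"
  by (simp add: Z3_times_D6_def dihedral_group_def)

lemma one_Z3_times_D6: "\<one>\<^bsub>Z3_times_D6\<^esub> = (0, 0, False)"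
  by (simp add: Z3_times_D6_def dihedral_group_def)

lemma card_Z3_times_D6: "card (carrier Z3_times_D6) = 18"
  by (simp add: carrier_Z3_times_D6 card_cartesian_product)

text \<open>
  \<open>Z3_times_D6\<close> is presented by generators \<open>x, y, z\<close> with the relations
  \<open>x\<^sup>3 = y\<^sup>3 = z\<^sup>2 = 1\<close>, \<open>x z = z x\<^sup>-\<^sup>1\<close>, \<open>y x = x y\<close>, \<open>y z = z y\<close>: the relations hold in it,
  and every group in which they hold receives a unique homomorphism from it that maps the
  generators accordingly.
\<close>

definition Z3_D6_relations :: "('a, 'b) monoid_scheme \<Rightarrow> 'a \<Rightarrow> 'a \<Rightarrow> 'a \<Rightarrow> bool" where
  "Z3_D6_relations G x y z \<longleftrightarrow>
     x \<in> carrier G \<and> y \<in> carrier G \<and> z \<in> carrier G \<and>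
     x [^]\<^bsub>G\<^esub> (3::nat) = \<one>\<^bsub>G\<^esub> \<and> y [^]\<^bsub>G\<^esub> (3::nat) = \<one>\<^bsub>G\<^esub> \<and> z [^]\<^bsub>G\<^esub> (2::nat) = \<one>\<^bsub>G\<^esub> \<and>
     x \<otimes>\<^bsub>G\<^esub> z = z \<otimes>\<^bsub>G\<^esub> inv\<^bsub>G\<^esub> x \<and> y \<otimes>\<^bsub>G\<^esub> x = x \<otimes>\<^bsub>G\<^esub> y \<and> y \<otimes>\<^bsub>G\<^esub> z = z \<otimes>\<^bsub>G\<^esub> y"

lemma Z3_D6_relations_Z3_times_D6:
  "Z3_D6_relations Z3_times_D6 (0, 1, False) (1, 0, False) (0, 0, True)"
proof -
  interpret group Z3_times_D6 by (rule group_Z3_times_D6)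
  have "inv\<^bsub>Z3_times_D6\<^esub> (0, 1, False) = (0, 2, False)"
    by (rule inv_equality)
      (auto simp: carrier_Z3_times_D6 mult_Z3_times_D6 one_Z3_times_D6)
  then show ?thesis
    by (simp add: Z3_D6_relations_def carrier_Z3_times_D6 mult_Z3_times_D6 one_Z3_times_D6
        numeral_2_eq_2 numeral_3_eq_3)
qed

lemma ex_hom_Z3_times_D6:
  assumes "group H" and rel: "Z3_D6_relations H x y z"
  shows "\<exists>h \<in> hom Z3_times_D6 H.
    h (0, 1, False) = x \<and> h (1, 0, False) = y \<and> h (0, 0, True) = z"
proof -
  interpret H: group H by fact
  have c [simp]: "x \<in> carrier H" "y \<in> carrier H" "z \<in> carrier H"
    and xz: "x \<otimes>\<^bsub>H\<^esub> z = z \<otimes>\<^bsub>H\<^esub> inv\<^bsub>H\<^esub> x"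
    and yx: "y \<otimes>\<^bsub>H\<^esub> x = x \<otimes>\<^bsub>H\<^esub> y" and yz: "y \<otimes>\<^bsub>H\<^esub> z = z \<otimes>\<^bsub>H\<^esub> y"
    using rel by (auto simp: Z3_D6_relations_def)
  have x3: "x \<otimes>\<^bsub>H\<^esub> (x \<otimes>\<^bsub>H\<^esub> x) = \<one>\<^bsub>H\<^esub>"
    and y3: "y \<otimes>\<^bsub>H\<^esub> (y \<otimes>\<^bsub>H\<^esub> y) = \<one>\<^bsub>H\<^esub>" and zz: "z \<otimes>\<^bsub>H\<^esub> z = \<one>\<^bsub>H\<^esub>"
    using rel by (auto simp: Z3_D6_relations_def numeral_eq_Suc H.m_assoc)
  have ix: "inv\<^bsub>H\<^esub> x = x \<otimes>\<^bsub>H\<^esub> x"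
    by (rule H.inv_equality) (use x3 in \<open>simp_all add: H.m_assoc\<close>)
  have zx: "z \<otimes>\<^bsub>H\<^esub> x = x \<otimes>\<^bsub>H\<^esub> (x \<otimes>\<^bsub>H\<^esub> z)"
  proof -
    have "x \<otimes>\<^bsub>H\<^esub> (x \<otimes>\<^bsub>H\<^esub> z) = x \<otimes>\<^bsub>H\<^esub> z \<otimes>\<^bsub>H\<^esub> inv\<^bsub>H\<^esub> x"
      by (metis xz H.m_assoc H.inv_closed c(1,3))
    also have "\<dots> = z \<otimes>\<^bsub>H\<^esub> (x \<otimes>\<^bsub>H\<^esub> (x \<otimes>\<^bsub>H\<^esub> x) \<otimes>\<^bsub>H\<^esub> x)"
      by (simp add: xz ix H.m_assoc)
    finally show ?thesis by (simp add: x3)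
  qed
  have tail: "u \<otimes>\<^bsub>H\<^esub> (v \<otimes>\<^bsub>H\<^esub> w) = t \<otimes>\<^bsub>H\<^esub> w"
    if "u \<otimes>\<^bsub>H\<^esub> v = t" "u \<in> carrier H" "v \<in> carrier H" "w \<in> carrier H" for u v w t
    using that by (simp add: H.m_assoc [symmetric])
  have t3: "u \<otimes>\<^bsub>H\<^esub> (u \<otimes>\<^bsub>H\<^esub> (u \<otimes>\<^bsub>H\<^esub> w)) = w"
    if "u \<otimes>\<^bsub>H\<^esub> (u \<otimes>\<^bsub>H\<^esub> u) = \<one>\<^bsub>H\<^esub>" "u \<in> carrier H" "w \<in> carrier H" for u w
    using tail [OF that(1), of w] that by (simp add: H.m_assoc)
  have zx': "z \<otimes>\<^bsub>H\<^esub> (x \<otimes>\<^bsub>H\<^esub> w) = x \<otimes>\<^bsub>H\<^esub> (x \<otimes>\<^bsub>H\<^esub> (z \<otimes>\<^bsub>H\<^esub> w))"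
    and xy': "x \<otimes>\<^bsub>H\<^esub> (y \<otimes>\<^bsub>H\<^esub> w) = y \<otimes>\<^bsub>H\<^esub> (x \<otimes>\<^bsub>H\<^esub> w)"
    and zy': "z \<otimes>\<^bsub>H\<^esub> (y \<otimes>\<^bsub>H\<^esub> w) = y \<otimes>\<^bsub>H\<^esub> (z \<otimes>\<^bsub>H\<^esub> w)"
    and zz': "z \<otimes>\<^bsub>H\<^esub> (z \<otimes>\<^bsub>H\<^esub> w) = w" if "w \<in> carrier H" for w
    using that tail [OF zx, of w] tail [OF yx [symmetric], of w] tail [OF yz [symmetric], of w]
      tail [OF zz, of w]
    by (simp_all add: H.m_assoc)
  note nf = H.m_assoc x3 y3 zz zx yx [symmetric] yz [symmetric]
    t3 [OF x3] t3 [OF y3] zx' xy' zy' zz'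
  define P where "P w i = (if i = 0 then \<one>\<^bsub>H\<^esub> else if i = 1 then w else w \<otimes>\<^bsub>H\<^esub> w)" for w and i :: int
  define h where "h = (\<lambda>(i, j, s). P y i \<otimes>\<^bsub>H\<^esub> (P x j \<otimes>\<^bsub>H\<^esub> (if s then z else \<one>\<^bsub>H\<^esub>)))"
  have "\<forall>s. \<forall>t. \<forall>i\<in>{0, 1, 2}. \<forall>j\<in>{0, 1, 2}. \<forall>i'\<in>{0, 1, 2}. \<forall>j'\<in>{0, 1, 2}.
      h ((i, j, s) \<otimes>\<^bsub>Z3_times_D6\<^esub> (i', j', t)) = h (i, j, s) \<otimes>\<^bsub>H\<^esub> h (i', j', t)"
    by (simp add: all_bool_eq mult_Z3_times_D6 h_def P_def nf)
  then have "h (p \<otimes>\<^bsub>Z3_times_D6\<^esub> q) = h p \<otimes>\<^bsub>H\<^esub> h q"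
    if "p \<in> carrier Z3_times_D6" "q \<in> carrier Z3_times_D6" for p q
    using that unfolding carrier_Z3_times_D6 by (elim SigmaE) blast
  moreover have "h p \<in> carrier H" for p
    by (cases p) (simp add: h_def P_def)
  ultimately have "h \<in> hom Z3_times_D6 H"
    by (auto intro!: homI)
  then show ?thesis
    by (rule bexI [rotated]) (simp add: h_def P_def)
qed

lemma hom_Z3_times_D6_unique:
  assumes g: "g \<in> hom Z3_times_D6 H" and h: "h \<in> hom Z3_times_D6 H"
    and gens: "g (0, 1, False) = h (0, 1, False)" "g (1, 0, False) = h (1, 0, False)"
      "g (0, 0, True) = h (0, 0, True)"
    and p: "p \<in> carrier Z3_times_D6"
  shows "g p = h p"
proof -
  have eq: "g (q \<otimes>\<^bsub>Z3_times_D6\<^esub> r) = h (q \<otimes>\<^bsub>Z3_times_D6\<^esub> r)"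
    if "g q = h q" "g r = h r" "q \<in> carrier Z3_times_D6" "r \<in> carrier Z3_times_D6" for q r
    using that hom_mult [OF g] hom_mult [OF h] by simp
  have 0: "g (0, 0, False) = h (0, 0, False)"
    using eq [OF gens(3) gens(3)] by (simp add: carrier_Z3_times_D6 mult_Z3_times_D6)
  have 1: "g (i, 0, False) = h (i, 0, False)" "g (0, i, False) = h (0, i, False)"
    "g (0, 0, s) = h (0, 0, s)" if "i \<in> {0, 1, 2}" for i s
    using that 0 gens eq [OF gens(1) gens(1)] eq [OF gens(2) gens(2)]
    by (auto simp: carrier_Z3_times_D6 mult_Z3_times_D6) (cases s; simp)+
  obtain i j s where ijs: "p = (i, j, s)" "i \<in> {0, 1, 2}" "j \<in> {0, 1, 2}"
    using p by (auto simp: carrier_Z3_times_D6)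
  have "g (i, j, False) = h (i, j, False)"
    using eq [OF 1(1) [OF ijs(2)] 1(2) [OF ijs(3)]] ijs
    by (auto simp: carrier_Z3_times_D6 mult_Z3_times_D6)
  from eq [OF this 1(3) [of 0 s]] ijs show ?thesis
    by (auto simp: carrier_Z3_times_D6 mult_Z3_times_D6)
qed

end

theory Submission
  imports Defs
begin

text \<open>
  Write an element of the group ring as \<open>f(x, y) + g(x, y) z\<close>. Splitting off the characters of \<open>Z\<close> and
  of \<open>\<langle>X\<rangle>\<close> factors its determinant as \<open>N(U) N(V) N(H)\<^sup>2\<close>, where \<open>N\<close> is the group determinant of
  \<open>\<langle>Y\<rangle> = \<int>\<^sub>3\<close>, \<open>U = (f + g)(1, y)\<close>, \<open>V = (f - g)(1, y)\<close> and
  \<open>H = f(\<omega>, y) f(\<omega>\<^sup>2, y) - g(\<omega>, y) g(\<omega>\<^sup>2, y)\<close> for a primitive cube root of unity \<open>\<omega>\<close>; note that \<open>H\<close>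
  has integer coefficients. Now \<open>U \<equiv> V\<close> modulo \<open>2\<close> and \<open>H \<equiv> U V\<close> modulo \<open>3\<close>, and the latter gives
  \<open>N(H) \<equiv> N(U) N(V)\<close> modulo \<open>9\<close>. Hence the determinant is a cube modulo \<open>9\<close>, an even determinant is
  divisible by \<open>4\<close>, and, since a value of \<open>N\<close> divisible by \<open>3\<close> is divisible by \<open>9\<close>,
  a determinant divisible by \<open>3\<close> is divisible by \<open>9 \<cdot> 9\<^sup>2 = 3\<^sup>6\<close>. Every integer that meets these
  conditions is a determinant: adding \<open>k\<close> to all coefficients changes only the factor of the trivial
  character, which yields arithmetic progressions of determinants.
\<close>

section \<open>Circulants of order 3 and the group ring of Z_3\<close>

definition c3_det :: "(int \<Rightarrow> int) \<Rightarrow> int" where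
  "c3_det p = p 0 ^ 3 + p 1 ^ 3 + p 2 ^ 3 - 3 * p 0 * p 1 * p 2"

text \<open>Cyclic convolution, the product in the group ring of Z_3; \<open>circulant3\<close> is
  its regular representation.\<close>

definition c3_mult :: "(int \<Rightarrow> int) \<Rightarrow> (int \<Rightarrow> int) \<Rightarrow> int \<Rightarrow> int" where
  "c3_mult p q k = p 0 * q (k mod 3) + p 1 * q ((k - 1) mod 3) + p 2 * q ((k - 2) mod 3)"

definition circulant3 :: "(int \<Rightarrow> int) \<Rightarrow> int mat" where
  "circulant3 p = mat 3 3 (\<lambda>(i, j). p ((int i - int j) mod 3))"

lemma less_3_cases: "i < 3 \<longleftrightarrow> i = 0 \<or> i = 1 \<or> i = (2 :: nat)"
  by auto

lemma sum_atLeast0_lessThan_3: "(\<Sum>i = 0..<3. f i) = f 0 + f 1 + f (2 :: nat)"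
  by (simp add: numeral_3_eq_3 numeral_2_eq_2)

lemma circulant3_carrier [simp]: "circulant3 p \<in> carrier_mat 3 3"
  by (simp add: circulant3_def)

lemma circulant3_mult: "circulant3 p * circulant3 q = circulant3 (c3_mult p q)"
  by (rule eq_matI)
    (auto simp: circulant3_def c3_mult_def scalar_prod_def sum_atLeast0_lessThan_3 less_3_cases
      algebra_simps)

lemma circulant3_mult_commute: "circulant3 p * circulant3 q = circulant3 q * circulant3 p"
  unfolding circulant3_mult
  by (rule eq_matI) (auto simp: circulant3_def c3_mult_def less_3_cases algebra_simps)

lemma circulant3_diff: "circulant3 p - circulant3 q = circulant3 (\<lambda>k. p k - q k)"
  by (rule eq_matI) (auto simp: circulant3_def)

lemma det_circulant3: "det (circulant3 p) = c3_det p"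
proof -
  have 2: "det (mat 2 2 f) = f (0, 0) * f (1, 1) - f (0, 1) * f (1, 0)" for f :: "nat \<times> nat \<Rightarrow> int"
  proof -
    have "det (mat 2 2 f) = (\<Sum>j<2. mat 2 2 f $$ (0, j) * cofactor (mat 2 2 f) 0 j)"
      by (rule laplace_expansion_row) auto
    then show ?thesis
      by (simp add: numeral_2_eq_2 cofactor_def mat_delete_def det_single)
  qed
  have del: "mat_delete (circulant3 p) 0 j =
      mat 2 2 (\<lambda>(r, c). circulant3 p $$ (Suc r, if c < j then c else Suc c))" for j
    by (rule eq_matI) (auto simp: mat_delete_def circulant3_def)
  have "det (circulant3 p) = (\<Sum>j<3. circulant3 p $$ (0, j) * cofactor (circulant3 p) 0 j)"
    by (rule laplace_expansion_row) auto
  also have "{..<3 :: nat} = {0, 1, 2}"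
    by auto
  finally show ?thesis
    by (simp add: cofactor_def del 2)
      (simp add: circulant3_def c3_det_def algebra_simps power2_eq_square power3_eq_cube)
qed

text \<open>The cubic form inherits multiplicativity from \<open>det\<close> through the regular
  representation.\<close>

lemma c3_det_mult: "c3_det (c3_mult p q) = c3_det p * c3_det q"
  unfolding det_circulant3 [symmetric] circulant3_mult [symmetric]
  by (rule det_mult [where n = 3]) auto

section \<open>Determinants of block matrices\<close>

lemma mat_four_block:
  "mat (n + m) (n + m) f = four_block_mat (mat n n f) (mat n m (\<lambda>(i, j). f (i, n + j)))
     (mat m n (\<lambda>(i, j). f (n + i, j))) (mat m m (\<lambda>(i, j). f (n + i, n + j)))"
  by (rule eq_matI) auto

text \<open>By \<open>eq\<close>, conjugation with the unipotent block matrix \<open>?L\<close>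
  clears the upper right block. It is written as \<open>?L * ?M = ?N * ?L\<close>, so no inverse of
  \<open>?L\<close> has to be computed.\<close>

lemma det_four_block_mat_similar_lower:
  fixes A :: "'a :: idom mat"
  assumes A: "A \<in> carrier_mat n n" and B: "B \<in> carrier_mat n m" and C: "C \<in> carrier_mat m n"
    and D: "D \<in> carrier_mat m m" and S: "S \<in> carrier_mat n m"
    and eq: "B + S * D = (A + S * C) * S"
  shows "det (four_block_mat A B C D) = det (A + S * C) * det (D - C * S)"
proof -
  let ?L = "four_block_mat (1\<^sub>m n) S (0\<^sub>m m n) (1\<^sub>m m)"
  let ?M = "four_block_mat A B C D"
  let ?N = "four_block_mat (A + S * C) (0\<^sub>m n m) C (D - C * S)"
  have AC: "A + S * C \<in> carrier_mat n n" and DC: "D - C * S \<in> carrier_mat m m"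
    using A C D S by (auto intro: minus_carrier_mat)
  have L: "?L \<in> carrier_mat (n + m) (n + m)" and M: "?M \<in> carrier_mat (n + m) (n + m)"
    and N: "?N \<in> carrier_mat (n + m) (n + m)"
    using A D AC DC by (simp_all add: four_block_carrier_mat)
  have D': "C * S + (D - C * S) = D"
    using C D S by (intro eq_matI) auto
  have "?L * ?M = four_block_mat (1\<^sub>m n * A + S * C) (1\<^sub>m n * B + S * D)
      (0\<^sub>m m n * A + 1\<^sub>m m * C) (0\<^sub>m m n * B + 1\<^sub>m m * D)"
    by (rule mult_four_block_mat [OF one_carrier_mat S zero_carrier_mat one_carrier_mat A B C D])
  also have "\<dots> = four_block_mat (A + S * C) ((A + S * C) * S) C D"
    unfolding eq [symmetric] using A B C D by simp
  also have "\<dots> = four_block_mat ((A + S * C) * 1\<^sub>m n + 0\<^sub>m n m * 0\<^sub>m m n)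
      ((A + S * C) * S + 0\<^sub>m n m * 1\<^sub>m m) (C * 1\<^sub>m n + (D - C * S) * 0\<^sub>m m n)
      (C * S + (D - C * S) * 1\<^sub>m m)"
    using AC C DC S D' mult_carrier_mat [OF AC S] by simp
  also have "\<dots> = ?N * ?L"
    by (rule mult_four_block_mat [OF AC zero_carrier_mat C DC
          one_carrier_mat S zero_carrier_mat one_carrier_mat, symmetric])
  finally have "det ?L * det ?M = det ?N * det ?L"
    by (simp flip: det_mult [OF L M] det_mult [OF N L])
  moreover have "det ?L = 1"
    using S by (subst det_four_block_mat_lower_left_zero [of _ n _ m]) auto
  moreover have "det ?N = det (A + S * C) * det (D - C * S)"
    using AC C DC by (intro det_four_block_mat_upper_right_zero) auto
  ultimately show ?thesis by simp
qed

section \<open>Splitting off the trivial character of the rotations\<close>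

text \<open>The row and column index \<open>3 j + i\<close> stands for \<open>X\<^sup>j Y\<^sup>i\<close>.\<close>

definition dihedral_block :: "(int \<Rightarrow> int \<Rightarrow> int) \<Rightarrow> (int \<Rightarrow> int \<Rightarrow> int) \<Rightarrow> int mat" where
  "dihedral_block f g = mat 9 9 (\<lambda>(r, c).
     f ((int (r div 3) - int (c div 3)) mod 3) ((int (r mod 3) - int (c mod 3)) mod 3) +
     g ((int (r div 3) + int (c div 3)) mod 3) ((int (r mod 3) - int (c mod 3)) mod 3))"

text \<open>
  For \<open>F = \<Sum>j. f j x\<^sup>j\<close> and \<open>G = \<Sum>j. g j x\<^sup>j\<close> with coefficients in the group ring of \<open>\<int>\<^sub>3\<close>, this is
  \<open>F(\<omega>) F(\<omega>\<^sup>2) - G(\<omega>) G(\<omega>\<^sup>2)\<close>, written as the 2 by 2 determinant that the elimination in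
  \<open>det_dihedral_block\<close> leaves.
\<close>

definition omega_part :: "(int \<Rightarrow> int \<Rightarrow> int) \<Rightarrow> (int \<Rightarrow> int \<Rightarrow> int) \<Rightarrow> int \<Rightarrow> int" where
  "omega_part f g k =
     c3_mult (\<lambda>i. f 0 i + g 2 i - f 1 i - g 1 i) (\<lambda>i. f 0 i + g 1 i - f 2 i - g 2 i) k -
     c3_mult (\<lambda>i. f 2 i + g 0 i - f 1 i - g 1 i) (\<lambda>i. f 1 i + g 0 i - f 2 i - g 2 i) k"

text \<open>In the 3 by 3 array of circulants every block column has the same sum, the image under X
  = 1. Splitting this off leaves the 2-dimensional representation of D_6 over the commutative ring
  of circulants.\<close>

lemma det_dihedral_block:
  "det (dihedral_block f g) =
     c3_det (\<lambda>i. f 0 i + f 1 i + f 2 i + (g 0 i + g 1 i + g 2 i)) * c3_det (omega_part f g)"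
proof -
  let ?w = "\<lambda>(r, c).
     f ((int (r div 3) - int (c div 3)) mod 3) ((int (r mod 3) - int (c mod 3)) mod 3) +
     g ((int (r div 3) + int (c div 3)) mod 3) ((int (r mod 3) - int (c mod 3)) mod 3)"
  define A where "A = mat 3 3 ?w"
  define B where "B = mat 3 6 (\<lambda>(i, j). ?w (i, 3 + j))"
  define C where "C = mat 6 3 (\<lambda>(i, j). ?w (3 + i, j))"
  define D where "D = mat 6 6 (\<lambda>(i, j). ?w (3 + i, 3 + j))"
  \<comment> \<open>Two identity blocks side by side: left multiplication by \<open>S\<close> adds
    the two lower block rows, which completes the sum over the powers of X.\<close>
  define S :: "int mat" where "S = mat 3 6 (\<lambda>(i, j). if j mod 3 = i then 1 else 0)"
  let ?U = "\<lambda>i. f 0 i + f 1 i + f 2 i + (g 0 i + g 1 i + g 2 i)"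
  have S [simp]: "S \<in> carrier_mat 3 6" and S_dim [simp]: "dim_row S = 3" "dim_col S = 6"
    by (simp_all add: S_def)
  have six: "i < 6 \<longleftrightarrow> i = 0 \<or> i = 1 \<or> i = 2 \<or> i = 3 \<or> i = 4 \<or> i = (5 :: nat)" for i
    by auto
  have sum6: "(\<Sum>i = 0..<6. h i) = h 0 + h 1 + h 2 + h 3 + h 4 + h (5 :: nat)" for h :: "nat \<Rightarrow> int"
    by (simp add: eval_nat_numeral)
  have SX: "(S * M) $$ (i, j) = M $$ (i, j) + M $$ (3 + i, j)"
    if "i < 3" "j < k" "M \<in> carrier_mat 6 k" for M i j k
    using that by (auto simp: S_def scalar_prod_def sum6 less_3_cases)
  have XS: "(M * S) $$ (i, j) = M $$ (i, j mod 3)"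
    if "i < k" "j < 6" "M \<in> carrier_mat k 3" for M i j k
    using that by (auto simp: S_def scalar_prod_def sum_atLeast0_lessThan_3 six)
  have AC: "A + S * C = circulant3 ?U"
  proof (rule eq_matI, goal_cases)
    case (1 i j)
    then have "i < 3" "j < 3" by (auto simp: circulant3_def)
    then show ?case
      by (simp add: SX [of _ _ 3] circulant3_def A_def C_def del: index_mult_mat(1))
  qed (auto simp: circulant3_def A_def C_def)
  have BD: "B + S * D = circulant3 ?U * S"
  proof (rule eq_matI, goal_cases)
    case (1 i j)
    then have ij: "i < 3" "j < 6" by (auto simp: circulant3_def S_def)
    then have "j div 3 = 0 \<or> j div 3 = 1" by auto
    then show ?case
      using ij by (elim disjE)
        (simp_all add: SX [of _ _ 6] XS [of _ 3] circulant3_def B_def D_def del: index_mult_mat(1))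
  qed (auto simp: circulant3_def S_def B_def D_def)
  let ?r11 = "\<lambda>i. f 0 i + g 2 i - f 1 i - g 1 i" and ?r12 = "\<lambda>i. f 2 i + g 0 i - f 1 i - g 1 i"
  let ?r21 = "\<lambda>i. f 1 i + g 0 i - f 2 i - g 2 i" and ?r22 = "\<lambda>i. f 0 i + g 1 i - f 2 i - g 2 i"
  have DC: "D - C * S =
      four_block_mat (circulant3 ?r11) (circulant3 ?r12) (circulant3 ?r21) (circulant3 ?r22)"
  proof (rule eq_matI, goal_cases)
    case (1 i j)
    then have "i < 6" "j < 6" by (auto simp: circulant3_def)
    then have "i < 3 \<or> (\<exists>i'<3. i = 3 + i')" "j < 3 \<or> (\<exists>j'<3. j = 3 + j')"
      by presburger+
    then show ?case
      by (elim disjE exE conjE; hypsubst?)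
        (simp_all add: XS [of _ 6] circulant3_def C_def D_def del: index_mult_mat(1))
  qed (auto simp: circulant3_def S_def C_def D_def)
  have "dihedral_block f g = four_block_mat A B C D"
    using mat_four_block [of 3 6 ?w] by (simp add: dihedral_block_def A_def B_def C_def D_def)
  also have "det \<dots> = det (A + S * C) * det (D - C * S)"
  proof (rule det_four_block_mat_similar_lower)
    show "A \<in> carrier_mat 3 3" "B \<in> carrier_mat 3 6" "C \<in> carrier_mat 6 3" "D \<in> carrier_mat 6 6"
      by (simp_all add: A_def B_def C_def D_def)
    show "B + S * D = (A + S * C) * S"
      by (simp only: AC BD)
  qed simp
  \<comment> \<open>The blocks are commuting circulants, so the 2 by 2 determinant may be taken over
    them first.\<close>
  also have "det (D - C * S) =
      det (circulant3 ?r11 * circulant3 ?r22 - circulant3 ?r12 * circulant3 ?r21)"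
    unfolding DC by (rule det_four_block_mat [OF circulant3_carrier circulant3_carrier
          circulant3_carrier circulant3_carrier circulant3_mult_commute])
  also have "circulant3 ?r11 * circulant3 ?r22 - circulant3 ?r12 * circulant3 ?r21 =
      circulant3 (omega_part f g)"
    by (simp add: circulant3_mult circulant3_diff omega_part_def [abs_def])
  finally show ?thesis
    by (simp only: AC det_circulant3)
qed

section \<open>The group determinant as a product of cubic forms\<close>

lemma det_four_block_mat_symmetric:
  fixes P Q :: "'a :: idom mat"
  assumes P: "P \<in> carrier_mat n n" and Q: "Q \<in> carrier_mat n n"
  shows "det (four_block_mat P Q Q P) = det (P + Q) * det (P - Q)"
  \<comment> \<open>With the identity as \<open>S\<close>, the required equation is
    \<open>Q + P = P + Q\<close>.\<close>
  using det_four_block_mat_similar_lower [OF P Q Q P one_carrier_mat] P Q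
  by (simp add: comm_add_mat [OF P Q])

lemma c3_det_cong:
  "p 0 = q 0 \<Longrightarrow> p 1 = q 1 \<Longrightarrow> p 2 = q 2 \<Longrightarrow> c3_det p = c3_det q"
  by (simp add: c3_det_def)

text \<open>The mixed terms in \<open>f\<close> and \<open>g\<close> cancel, so
  \<open>omega_part\<close> is even in \<open>g\<close>. The halves Z = 1 and Z = -1 therefore share
  this factor, whence its square in the determinant.\<close>

lemma c3_det_omega_part_minus: "c3_det (omega_part f (\<lambda>j i. - g j i)) = c3_det (omega_part f g)"
  by (rule c3_det_cong) (simp_all add: omega_part_def c3_mult_def algebra_simps)

text \<open>Elements without Z come first and the power of X varies more slowly than that of Y, so
  the group matrix falls into four 9 by 9 blocks indexed as in
  \<open>dihedral_block\<close>.\<close>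

definition Z3_D6_enum :: "nat \<Rightarrow> int \<times> int \<times> bool" where
  "Z3_D6_enum r = (if r < 9 then (int (r mod 3), int (r div 3), False)
     else (int ((r - 9) mod 3), int ((r - 9) div 3), True))"

lemma bij_betw_Z3_D6_enum: "bij_betw Z3_D6_enum {0..<18} (carrier Z3_times_D6)"
  by (rule bij_betw_byWitness [where f' = "\<lambda>(i, j, s). nat i + 3 * nat j + (if s then 9 else 0)"])
    (auto simp: Z3_D6_enum_def carrier_Z3_times_D6)

lemma inv_Z3_times_D6:
  assumes "i \<in> {0, 1, 2}" "j \<in> {0, 1, 2}"
  shows "inv\<^bsub>Z3_times_D6\<^esub> (i, j, s) = ((- i) mod 3, (if s then j else - j) mod 3, s)"
proof -
  interpret group Z3_times_D6 by (rule group_Z3_times_D6)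
  show ?thesis
    by (rule inv_equality)
      (use assms in \<open>auto simp: carrier_Z3_times_D6 mult_Z3_times_D6 one_Z3_times_D6\<close>)
qed

text \<open>Inverting an element that contains Z keeps its exponent of X. Hence both off-diagonal
  blocks carry \<open>g\<close> at the sum of the X exponents; they coincide, and the symmetric
  block formula applies.\<close>

theorem group_det_Z3_times_D6:
  fixes a :: "int \<times> int \<times> bool \<Rightarrow> int"
  defines "f \<equiv> \<lambda>j i. a (i, j, False)" and "g \<equiv> \<lambda>j i. a (i, j, True)"
  shows "group_det Z3_times_D6 a =
    c3_det (\<lambda>i. f 0 i + f 1 i + f 2 i + (g 0 i + g 1 i + g 2 i)) *
    c3_det (\<lambda>i. f 0 i + f 1 i + f 2 i - (g 0 i + g 1 i + g 2 i)) *
    c3_det (omega_part f g) ^ 2"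
proof -
  let ?P = "mat 9 9 (\<lambda>(r, c).
    f ((int (r div 3) - int (c div 3)) mod 3) ((int (r mod 3) - int (c mod 3)) mod 3))"
  let ?Q = "mat 9 9 (\<lambda>(r, c).
    g ((int (r div 3) + int (c div 3)) mod 3) ((int (r mod 3) - int (c mod 3)) mod 3))"
  have inv: "inv\<^bsub>Z3_times_D6\<^esub> (int (r mod 3), int (r div 3), s) =
      ((- int (r mod 3)) mod 3, (if s then int (r div 3) else - int (r div 3)) mod 3, s)"
    if "r < 9" for r s
  proof (rule inv_Z3_times_D6)
    have "r mod 3 < 3" "r div 3 < 3" using that by auto
    then show "int (r mod 3) \<in> {0, 1, 2}" "int (r div 3) \<in> {0, 1, 2}"
      by (auto simp: less_3_cases)
  qed
  have "finite (carrier Z3_times_D6)"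
    by (simp add: carrier_Z3_times_D6)
  then have "group_det Z3_times_D6 a = det (mat (9 + 9) (9 + 9) (\<lambda>(r, c).
      a (Z3_D6_enum r \<otimes>\<^bsub>Z3_times_D6\<^esub> inv\<^bsub>Z3_times_D6\<^esub> (Z3_D6_enum c))))"
    using group_det_eq [OF _ card_Z3_times_D6 [symmetric] bij_betw_Z3_D6_enum] by simp
  also have "mat (9 + 9) (9 + 9) (\<lambda>(r, c).
      a (Z3_D6_enum r \<otimes>\<^bsub>Z3_times_D6\<^esub> inv\<^bsub>Z3_times_D6\<^esub> (Z3_D6_enum c))) =
      four_block_mat ?P ?Q ?Q ?P"
    unfolding mat_four_block
    by (intro arg_cong4 [where f = four_block_mat] cong_mat)
      (auto simp: Z3_D6_enum_def inv mult_Z3_times_D6 f_def g_def mod_simps)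
  also have "det \<dots> = det (?P + ?Q) * det (?P - ?Q)"
    by (rule det_four_block_mat_symmetric) auto
  also have "?P + ?Q = dihedral_block f g"
    by (rule eq_matI) (auto simp: dihedral_block_def)
  also have "?P - ?Q = dihedral_block f (\<lambda>j i. - g j i)"
    by (rule eq_matI) (auto simp: dihedral_block_def)
  finally show ?thesis
    by (simp add: det_dihedral_block c3_det_omega_part_minus power2_eq_square algebra_simps)
qed

section \<open>Necessary conditions modulo 4, 9 and 3^6\<close>

lemma c3_det_cong_9:
  assumes "\<And>k. k \<in> {0, 1, 2} \<Longrightarrow> [p k = q k] (mod 3)"
  shows "[c3_det p = c3_det q] (mod 9)"
proof -
  have "\<exists>t. p k = q k + 3 * t" if "k \<in> {0, 1, 2}" for k
    using cong_sym [OF assms [OF that]] by (simp add: cong_iff_lin)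
  then obtain x y z where "p 0 = q 0 + 3 * x" "p 1 = q 1 + 3 * y" "p 2 = q 2 + 3 * z"
    by (meson insertCI)
  \<comment> \<open>Taylor expansion: the increments and the partial derivatives of the form are
    multiples of 3, so the linear terms are multiples of 9, as are the higher ones.\<close>
  then have "c3_det p - c3_det q = 9 * (x * q 0 ^ 2 + 3 * x ^ 2 * q 0 + 3 * x ^ 3 +
      y * q 1 ^ 2 + 3 * y ^ 2 * q 1 + 3 * y ^ 3 + z * q 2 ^ 2 + 3 * z ^ 2 * q 2 + 3 * z ^ 3 -
      x * q 1 * q 2 - q 0 * y * q 2 - q 0 * q 1 * z - 3 * x * y * q 2 - 3 * x * q 1 * z -
      3 * q 0 * y * z - 9 * x * y * z)"
    by (simp add: c3_det_def algebra_simps power2_eq_square power3_eq_cube)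
  then show ?thesis
    by (simp add: cong_iff_dvd_diff)
qed

lemma cube_mod_9:
  fixes x :: int
  assumes "\<not> 3 dvd x"
  shows "x ^ 3 mod 9 = 1 \<or> x ^ 3 mod 9 = 8"
proof -
  have "x mod 9 = 1 \<or> x mod 9 = 2 \<or> x mod 9 = 4 \<or> x mod 9 = 5 \<or> x mod 9 = 7 \<or> x mod 9 = 8"
    using assms by presburger
  moreover have "x ^ 3 mod 9 = (x mod 9) ^ 3 mod 9"
    by (simp add: power_mod)
  ultimately show ?thesis by auto
qed

text \<open>In Newton's identity \<open>eq\<close>, divisibility by 3 forces
  \<open>3 dvd ?s\<close>, and then both terms are multiples of 9.\<close>

lemma c3_det_3_dvd:
  assumes "3 dvd c3_det p"
  shows "9 dvd c3_det p"
proof -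
  let ?s = "p 0 + p 1 + p 2" and ?e = "p 0 * p 1 + p 1 * p 2 + p 2 * p 0"
  have eq: "c3_det p = ?s ^ 3 - 3 * (?s * ?e)"
    by (simp add: c3_det_def algebra_simps power2_eq_square power3_eq_cube)
  moreover have "3 dvd 3 * (?s * ?e)" by (rule dvd_triv_left)
  ultimately have "3 dvd ?s ^ 3"
    using assms by (metis dvd_diff_left_iff)
  moreover have mod_eq: "\<not> (y mod 9 = 1 \<or> y mod 9 = 8)" if "3 dvd y" for y :: int
    using that by presburger
  ultimately have "3 dvd ?s"
    using cube_mod_9 [of ?s] mod_eq by blast
  then obtain t where t: "?s = 3 * t" by blast
  have "c3_det p = 9 * (3 * t ^ 3 - t * ?e)"
    unfolding eq t by (simp add: power3_eq_cube)
  then show ?thesis by simp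
qed

lemma c3_det_even_iff: "even (c3_det p) \<longleftrightarrow> even (p 0 + p 1 + p 2 + p 0 * p 1 * p 2)"
  by (simp add: c3_det_def)

text \<open>At the prime above 3, \<omega> reduces to 1, so F(\<omega>) F(1/\<omega>) becomes F(1)
  F(1), and likewise for G.\<close>

lemma omega_part_cong_3:
  assumes "k \<in> {0, 1, 2}"
  shows "[omega_part f g k = c3_mult (\<lambda>i. f 0 i + f 1 i + f 2 i + (g 0 i + g 1 i + g 2 i))
    (\<lambda>i. f 0 i + f 1 i + f 2 i - (g 0 i + g 1 i + g 2 i)) k] (mod 3)"
proof -
  \<comment> \<open>The cofactor comes from F(1) F(1) - F(\<omega>) F(1/\<omega>) = 3 (f0 f1 + f1 f2
    + f2 f0) and the same identity for G.\<close>
  have "c3_mult (\<lambda>i. f 0 i + f 1 i + f 2 i + (g 0 i + g 1 i + g 2 i))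
    (\<lambda>i. f 0 i + f 1 i + f 2 i - (g 0 i + g 1 i + g 2 i)) k - omega_part f g k =
    3 * (c3_mult (f 0) (f 1) k + c3_mult (f 1) (f 2) k + c3_mult (f 2) (f 0) k -
      c3_mult (g 0) (g 1) k - c3_mult (g 1) (g 2) k - c3_mult (g 2) (g 0) k)"
    using assms by (auto simp: omega_part_def c3_mult_def algebra_simps)
  then show ?thesis
    by (intro cong_sym [of "c3_mult _ _ _"]) (simp only: cong_iff_dvd_diff dvd_triv_left)
qed

text \<open>One condition at 2 and one at 3; the four parts of the theorem are slices of this
  set.\<close>

definition Z3_D6_det_set :: "int set" where
  "Z3_D6_det_set = {d. (even d \<longrightarrow> 4 dvd d) \<and> (d mod 9 \<in> {1, 8} \<or> 3 ^ 6 dvd d)}"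

lemma group_det_Z3_times_D6_in: "group_det Z3_times_D6 a \<in> Z3_D6_det_set"
proof -
  define f g where "f = (\<lambda>j i. a (i, j, False))" and "g = (\<lambda>j i. a (i, j, True))"
  let ?U = "\<lambda>i. f 0 i + f 1 i + f 2 i + (g 0 i + g 1 i + g 2 i)"
  let ?V = "\<lambda>i. f 0 i + f 1 i + f 2 i - (g 0 i + g 1 i + g 2 i)"
  define m n where "m = c3_det ?U * c3_det ?V" and "n = c3_det (omega_part f g)"
  have d: "group_det Z3_times_D6 a = m * n ^ 2"
    by (simp add: group_det_Z3_times_D6 m_def n_def f_def g_def)
  \<comment> \<open>As a single value of the form, \<open>m\<close> can be compared with
    \<open>n\<close> modulo 9, and \<open>c3_det_3_dvd\<close> applies to it.\<close>
  have m: "m = c3_det (c3_mult ?U ?V)"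
    by (simp add: m_def c3_det_mult)
  have mn: "[n = m] (mod 9)"
    unfolding m n_def by (rule c3_det_cong_9) (rule omega_part_cong_3)
  \<comment> \<open>\<open>?U\<close> and \<open>?V\<close> agree modulo 2, so an even
    \<open>m\<close> has two even factors.\<close>
  have UV: "even (c3_det ?U) \<longleftrightarrow> even (c3_det ?V)"
    by (simp add: c3_det_even_iff)
  have "4 dvd m" if "even m"
  proof -
    have "2 dvd c3_det ?U" "2 dvd c3_det ?V" using that UV by (auto simp: m_def)
    then have "2 * 2 dvd m" unfolding m_def by (rule mult_dvd_mono)
    then show ?thesis by simp
  qed
  moreover have "4 dvd n ^ 2" if "even n"
    using that by (auto elim!: evenE simp: power2_eq_square)
  ultimately have 2: "even (m * n ^ 2) \<longrightarrow> 4 dvd m * n ^ 2"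
    by (auto intro: dvd_mult dvd_mult2)
  have "(m * n ^ 2) mod 9 \<in> {1, 8} \<or> 3 ^ 6 dvd m * n ^ 2"
  proof (cases "3 dvd m")
    case True
    then have "9 dvd m" unfolding m by (rule c3_det_3_dvd)
    moreover from this mn have "9 dvd n" by (simp add: cong_dvd_iff)
    ultimately have "9 * 9 ^ 2 dvd m * n ^ 2" by (intro mult_dvd_mono dvd_power_same)
    then show ?thesis by simp
  next
    case False
    have "[m * n ^ 2 = m * m ^ 2] (mod 9)"
      using mn by (intro cong_mult cong_pow) auto
    then have "(m * n ^ 2) mod 9 = m ^ 3 mod 9"
      by (simp add: cong_def power2_eq_square power3_eq_cube mult.assoc)
    with cube_mod_9 [OF False] show ?thesis by simp
  qed
  with 2 show ?thesis by (simp add: d Z3_D6_det_set_def)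
qed

section \<open>Realizing all remaining integers\<close>

definition coeff_table ::
    "int \<Rightarrow> int list list \<Rightarrow> int list list \<Rightarrow> int \<times> int \<times> bool \<Rightarrow> int" where
  "coeff_table k F G = (\<lambda>(i, j, s). k + (if s then G else F) ! nat j ! nat i)"

text \<open>The tables were found by a computer search.\<close>

lemma group_det_coeff_tables:
  "group_det Z3_times_D6 (coeff_table k [[1,0,0],[0,0,0],[0,0,0]] [[0,0,0],[0,0,0],[0,0,0]]) =
    18 * k + 1"
  "group_det Z3_times_D6 (coeff_table k [[0,0,0],[0,0,0],[0,0,0]] [[1,0,0],[0,0,0],[0,0,0]]) =
    - (18 * k + 1)"
  "group_det Z3_times_D6 (coeff_table k [[1,0,0],[0,0,1],[0,1,0]] [[0,1,0],[0,0,0],[0,0,0]]) =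
    2 * (18 * k + 4)"
  "group_det Z3_times_D6 (coeff_table k [[0,0,0],[0,0,0],[0,0,-1]] [[0,-1,0],[0,0,-1],[-1,0,0]]) =
    2 * (18 * k - 4)"
  "group_det Z3_times_D6 (coeff_table k [[0,0,0],[0,1,1],[0,0,0]] [[0,0,0],[0,0,0],[0,1,0]]) =
    3 ^ 5 * (18 * k + 3)"
  "group_det Z3_times_D6 (coeff_table k [[0,0,0],[0,0,0],[-1,0,0]] [[0,0,0],[0,0,0],[-1,0,-1]]) =
    3 ^ 5 * (18 * k - 3)"
  "group_det Z3_times_D6 (coeff_table k [[1,0,0],[0,1,0],[1,1,1]] [[0,0,0],[0,1,0],[1,1,1]]) =
    3 ^ 5 * (18 * k + 9)"
  "group_det Z3_times_D6 (coeff_table k [[0,1,0],[-1,0,0],[1,0,0]] [[-1,0,0],[0,0,0],[0,0,0]]) =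
    2 * 3 ^ 5 * (18 * k)"
  "group_det Z3_times_D6 (coeff_table k [[1,0,1],[0,0,1],[0,1,0]] [[1,0,1],[0,0,0],[0,0,0]]) =
    2 * 3 ^ 5 * (18 * k + 6)"
  "group_det Z3_times_D6 (coeff_table k [[0,-1,-1],[0,0,0],[0,0,0]] [[0,-1,0],[-1,0,0],[0,-1,-1]]) =
    2 * 3 ^ 5 * (18 * k - 6)"
  \<comment> \<open>The number next to \<open>18 * k\<close> is the sum of the 18 table entries; the
    constant in front is the product of the other factors, which do not depend on
    \<open>k\<close>.\<close>
  by (simp_all add: group_det_Z3_times_D6 coeff_table_def c3_det_def omega_part_def c3_mult_def
      algebra_simps power2_eq_square power3_eq_cube)

lemma Z3_D6_det_set_iff_not_3_dvd:
  assumes "\<not> 3 dvd d"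
  shows "d \<in> Z3_D6_det_set \<longleftrightarrow> (even d \<longrightarrow> 4 dvd d) \<and> (d mod 9 = 1 \<or> d mod 9 = 8)"
proof -
  have "\<not> 3 ^ 6 dvd d"
    using assms dvd_trans [of 3 "3 ^ 6" d] by auto
  then show ?thesis by (auto simp: Z3_D6_det_set_def)
qed

lemma Z3_D6_det_set_iff_3_dvd:
  assumes "3 dvd d"
  shows "d \<in> Z3_D6_det_set \<longleftrightarrow> (even d \<longrightarrow> 4 dvd d) \<and> 3 ^ 6 dvd d"
proof -
  have "d mod 9 \<noteq> 1" "d mod 9 \<noteq> 8" using assms by presburger+
  then show ?thesis by (auto simp: Z3_D6_det_set_def)
qed

text \<open>The cases have the form of the values in \<open>group_det_coeff_tables\<close>, so each
  comes with a witness.\<close>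

lemma Z3_D6_det_set_not_3_dvd_cases:
  assumes "d \<in> Z3_D6_det_set" and "\<not> 3 dvd d"
  obtains (odd_pos) k where "d = 18 * k + 1" | (odd_neg) k where "d = - (18 * k + 1)"
    | (even_pos) k where "d = 2 * (18 * k + 4)" | (even_neg) k where "d = 2 * (18 * k - 4)"
proof -
  have even: "even d \<longrightarrow> 4 dvd d" and "d mod 9 = 1 \<or> d mod 9 = 8"
    using assms Z3_D6_det_set_iff_not_3_dvd by blast+
  then have "d = 9 * (d div 9) + 1 \<or> d = 9 * (d div 9 + 1) - 1" by presburger
  then consider q where "d = 9 * q + 1" | q where "d = 9 * q - 1" by blast
  then show ?thesis
  proof cases
    case (1 q)
    show ?thesis
    proof (cases "even d")
      case True
      with even 1 have "4 dvd 9 * q + 1" by simp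
      \<comment> \<open>Reduces \<open>9 * q\<close> to \<open>q\<close> modulo 4.\<close>
      from dvd_diff [OF this, of "4 * (2 * q)"] have "4 dvd q + 1" by simp
      then obtain k where "q = 4 * k - 1" by (metis add_diff_cancel_right' dvdE)
      then show ?thesis using even_neg [of k] 1 by simp
    next
      case False
      with 1 obtain k where "q = 2 * k" by auto
      then show ?thesis using odd_pos [of k] 1 by simp
    qed
  next
    case (2 q)
    show ?thesis
    proof (cases "even d")
      case True
      with even 2 have "4 dvd 9 * q - 1" by simp
      from dvd_diff [OF this, of "4 * (2 * q)"] have "4 dvd q - 1" by simp
      then obtain k where "q = 4 * k + 1" by (metis diff_add_cancel dvdE)
      then show ?thesis using even_pos [of k] 2 by simp
    next
      case False
      with 2 obtain k where "q = 2 * k" by auto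
      then show ?thesis using odd_neg [of "- k"] 2 by simp
    qed
  qed
qed

lemma int_mod_3_cases:
  fixes n :: int
  obtains k where "n = 3 * k" | k where "n = 3 * k + 1" | k where "n = 3 * k - 1"
proof -
  have "n = 3 * (n div 3) \<or> n = 3 * (n div 3) + 1 \<or> n = 3 * (n div 3 + 1) - 1"
    by presburger
  then show ?thesis using that by blast
qed

text \<open>The bracket must run through all odd multiples of 3, or all multiples of 6, but a table
  moves it by 18. Hence three tables for each parity, chosen by \<open>m\<close> modulo 3.\<close>

lemma Z3_D6_det_set_3_dvd_cases:
  assumes "d \<in> Z3_D6_det_set" and "3 dvd d"
  obtains (odd) k where "d = 3 ^ 5 * (18 * k + 3)" | (odd_neg) k where "d = 3 ^ 5 * (18 * k - 3)"
    | (odd_9) k where "d = 3 ^ 5 * (18 * k + 9)" | (even) k where "d = 2 * 3 ^ 5 * (18 * k)"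
    | (even_6) k where "d = 2 * 3 ^ 5 * (18 * k + 6)" | (even_neg) k where "d = 2 * 3 ^ 5 * (18 * k - 6)"
proof -
  have even: "even d \<longrightarrow> 4 dvd d" and "3 ^ 6 dvd d"
    using assms Z3_D6_det_set_iff_3_dvd by blast+
  then obtain n where n: "d = 3 ^ 6 * n" by blast
  show ?thesis
  proof (cases "even n")
    case True
    with even have "4 dvd 729 * n" by (simp add: n)
    \<comment> \<open>\<open>729 = 4 * 182 + 1\<close>, so only \<open>n\<close> is left.\<close>
    from dvd_diff [OF this, of "4 * (182 * n)"] obtain m where m: "n = 4 * m" by (auto elim: dvdE)
    show ?thesis
      by (cases m rule: int_mod_3_cases) (use that(4-6) in \<open>simp_all add: n m\<close>)
  next
    case False
    then obtain m where m: "n = 2 * m + 1" by (rule oddE)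
    show ?thesis
      by (cases m rule: int_mod_3_cases) (use that(1-3) in \<open>simp_all add: n m\<close>)
  qed
qed

section \<open>The set of determinants and its four slices\<close>

theorem integer_group_dets_Z3_times_D6: "integer_group_dets Z3_times_D6 = Z3_D6_det_set"
proof
  show "integer_group_dets Z3_times_D6 \<subseteq> Z3_D6_det_set"
    by (auto simp: integer_group_dets_def group_det_Z3_times_D6_in)
  show "Z3_D6_det_set \<subseteq> integer_group_dets Z3_times_D6"
  proof
    fix d assume d: "d \<in> Z3_D6_det_set"
    show "d \<in> integer_group_dets Z3_times_D6"
    proof (cases "3 dvd d")
      case True
      with d show ?thesis
        unfolding integer_group_dets_def
        by (cases rule: Z3_D6_det_set_3_dvd_cases)
          (use group_det_coeff_tables [symmetric] in fast)+
    next
      case False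
      with d show ?thesis
        unfolding integer_group_dets_def
        by (cases rule: Z3_D6_det_set_not_3_dvd_cases)
          (use group_det_coeff_tables [symmetric] in fast)+
    qed
  qed
qed

lemma coprime_6_iff: "coprime d 6 \<longleftrightarrow> odd d \<and> \<not> 3 dvd (d :: int)"
proof -
  have "coprime d 6 \<longleftrightarrow> coprime d 2 \<and> coprime d 3"
    using coprime_mult_right_iff [of d 2 3] by simp
  moreover have "coprime d 3 \<longleftrightarrow> \<not> 3 dvd d"
    using prime_imp_coprime [of 3 d] coprime_absorb_left [of 3 d]
    by (auto simp: coprime_commute)
  ultimately show ?thesis by simp
qed

theorem theorem1p2:
  shows
    "{d \<in> integer_group_dets Z3_times_D6. coprime d 6} =
       {m :: int. [m = 1] (mod 18) \<or> [m = - 1] (mod 18)} \<and>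
     {d \<in> integer_group_dets Z3_times_D6. 6 dvd d} =
       {2^2 * 3^6 * m | m :: int. True} \<and>
     {d \<in> integer_group_dets Z3_times_D6. 2 dvd d \<and> \<not> 3 dvd d} =
       {2^2 * (9 * m + 2) | m :: int. True} \<union> {2^2 * (9 * m - 2) | m :: int. True} \<and>
     {d \<in> integer_group_dets Z3_times_D6. 3 dvd d \<and> \<not> 2 dvd d} =
       {3^6 * (2 * m + 1) | m :: int. True}"
proof (intro conjI)
  note S = integer_group_dets_Z3_times_D6
  show "{d \<in> integer_group_dets Z3_times_D6. coprime d 6} =
       {m :: int. [m = 1] (mod 18) \<or> [m = - 1] (mod 18)}"
    unfolding S coprime_6_iff
  proof (intro Set.set_eqI iffI; clarify)
    fix d :: int assume d: "d \<in> Z3_D6_det_set" "odd d" "\<not> 3 dvd d" "\<not> [d = - 1] (mod 18)"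
    from d(1,3) show "[d = 1] (mod 18)"
    proof (cases rule: Z3_D6_det_set_not_3_dvd_cases)
      case (odd_neg k)
      then have "[d = - 1] (mod 18)" by (simp add: cong_iff_dvd_diff)
      with d show ?thesis by simp
    qed (use d in \<open>auto simp: cong_iff_dvd_diff\<close>)
  next
    fix d :: int assume "[d = 1] (mod 18) \<or> [d = - 1] (mod 18)"
    then have "d mod 18 = 1 \<or> d mod 18 = 17" by (simp add: cong_def)
    then have "odd d" "\<not> 3 dvd d" "d mod 9 = 1 \<or> d mod 9 = 8" by presburger+
    then show "d \<in> Z3_D6_det_set \<and> odd d \<and> \<not> 3 dvd d"
      by (simp add: Z3_D6_det_set_iff_not_3_dvd)
  qed
  show "{d \<in> integer_group_dets Z3_times_D6. 6 dvd d} = {2^2 * 3^6 * m | m :: int. True}"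
    unfolding S
  proof (intro Set.set_eqI iffI; clarify)
    fix d :: int assume d: "d \<in> Z3_D6_det_set" "6 dvd d"
    then have "3 dvd d" "even d" by presburger+
    with d(1) show "\<exists>m. d = 2^2 * 3^6 * m \<and> True"
    proof (cases rule: Z3_D6_det_set_3_dvd_cases)
      case (even k)
      \<comment> \<open>Here and in the next two cases the witness is the bracket divided by
        6.\<close>
      then show ?thesis by (intro exI [of _ "3 * k"]) simp
    next
      case (even_6 k)
      then show ?thesis by (intro exI [of _ "3 * k + 1"]) simp
    next
      case (even_neg k)
      then show ?thesis by (intro exI [of _ "3 * k - 1"]) simp
    qed auto
  next
    fix m :: int
    show "2^2 * 3^6 * m \<in> Z3_D6_det_set \<and> 6 dvd 2^2 * 3^6 * m"
      using Z3_D6_det_set_iff_3_dvd [of "2^2 * 3^6 * m"] by simp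
  qed
  show "{d \<in> integer_group_dets Z3_times_D6. 2 dvd d \<and> \<not> 3 dvd d} =
       {2^2 * (9 * m + 2) | m :: int. True} \<union> {2^2 * (9 * m - 2) | m :: int. True}"
    unfolding S
  proof (intro equalityI subsetI)
    fix d assume "d \<in> {d \<in> Z3_D6_det_set. 2 dvd d \<and> \<not> 3 dvd d}"
    then have "d \<in> Z3_D6_det_set" "\<not> 3 dvd d" and even: "even d" by auto
    then show "d \<in> {2^2 * (9 * m + 2) | m :: int. True} \<union> {2^2 * (9 * m - 2) | m :: int. True}"
    proof (cases rule: Z3_D6_det_set_not_3_dvd_cases)
      case (even_pos k)
      then have "d = 2^2 * (9 * k + 2)" by simp
      then show ?thesis by blast
    next
      case (even_neg k)
      then have "d = 2^2 * (9 * k - 2)" by simp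
      then show ?thesis by blast
    qed (use even in auto)
  next
    fix d :: int
    assume "d \<in> {2^2 * (9 * m + 2) | m :: int. True} \<union> {2^2 * (9 * m - 2) | m :: int. True}"
    then obtain m where m: "d = 4 * (9 * m + 2) \<or> d = 4 * (9 * m - 2)" by auto
    then have "4 dvd d" by auto
    \<comment> \<open>\<open>4 * 2 = 8\<close> and \<open>- 8 = 1 - 9\<close> display the remainders
      modulo 9.\<close>
    moreover have "d = 8 + 9 * (4 * m) \<or> d = 1 + 9 * (4 * m - 1)" using m by auto
    then have mod_9: "d mod 9 = 1 \<or> d mod 9 = 8"
      by (elim disjE) (simp_all only: mod_mult_self2, simp_all)
    moreover from mod_9 have "\<not> 3 dvd d" by presburger
    ultimately show "d \<in> {d \<in> Z3_D6_det_set. 2 dvd d \<and> \<not> 3 dvd d}"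
      by (auto simp: Z3_D6_det_set_iff_not_3_dvd intro: dvd_trans [of 2 4])
  qed
  show "{d \<in> integer_group_dets Z3_times_D6. 3 dvd d \<and> \<not> 2 dvd d} =
       {3^6 * (2 * m + 1) | m :: int. True}"
    unfolding S
  proof (intro Set.set_eqI iffI; clarify)
    fix d :: int assume d: "d \<in> Z3_D6_det_set" "3 dvd d" "odd d"
    from d(1,2) show "\<exists>m. d = 3^6 * (2 * m + 1) \<and> True"
    proof (cases rule: Z3_D6_det_set_3_dvd_cases)
      case (odd k)
      \<comment> \<open>A factor 3 leaves the bracket, and the odd rest determines the witness;
        likewise in the next two cases.\<close>
      then show ?thesis by (intro exI [of _ "3 * k"]) simp
    next
      case (odd_neg k)
      then show ?thesis by (intro exI [of _ "3 * k - 1"]) simp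
    next
      case (odd_9 k)
      then show ?thesis by (intro exI [of _ "3 * k + 1"]) simp
    qed (use d in auto)
  next
    fix m :: int
    have "3 dvd 3^6 * (2 * m + 1)" by (rule dvd_mult2) simp
    then show "3^6 * (2 * m + 1) \<in> Z3_D6_det_set \<and> 3 dvd 3^6 * (2 * m + 1) \<and>
        odd (3^6 * (2 * m + 1))"
      using Z3_D6_det_set_iff_3_dvd [of "3^6 * (2 * m + 1)"] by simp
  qed
qed

end
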